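(* Let $r \geq 1$ and $\alpha \geq 2$ be real numbers. Then the sequence $$\frac{\left(\sum_{i=1}^n i^r\right)^{\alpha}}{\sum_{i=1}^n i^{\alpha(r+1)-1}}, \qquad n = 1, 2, 3, \ldots,$$ is decreasing (in the weak sense); that is, for every integer $n \geq 1$, $$\frac{\left(\sum_{i=1}^n i^r\right)^{\alpha}}{\sum_{i=1}^n i^{\alpha(r+1)-1}} \geq \frac{\left(\sum_{i=1}^{n+1} i^r\right)^{\alpha}}{\sum_{i=1}^{n+1} i^{\alpha(r+1)-1}}.$$
   Context: "Decreasing" is understood in the non-strict sense (for $r=1$, $\alpha=2$ the sequence is constant). *)

theory Defs
  imports Complex_Main
begin

end

theory Submission
  imports Defs
begin

text \<open>
  Write \<open>S k\<close> for the sum in the numerator.  A quotient of partial sums decreases as soon as the quotient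
  of the increments does, so it suffices that
  \<open>(S k powr \<alpha> - S (k-1) powr \<alpha>) / k powr (\<alpha> * (r+1) - 1)\<close> decreases.  This is the mean value of
  \<open>\<alpha> * x powr (\<alpha> - 1)\<close> on the interval of length \<open>1/k\<close> with midpoint
  \<open>(S k + S (k-1)) / (2 * k powr (r+1))\<close>.  The integrand is increasing and convex because
  \<open>\<alpha> \<ge> 2\<close>, so it is enough that the midpoints decrease; they are the trapezoidal sums of
  \<open>x powr r\<close> on the unit interval.  By the same principle on increments that reduces to the
  monotonicity of \<open>sinh (c * t) / sinh (d * t)\<close> in \<open>t\<close>, where \<open>c = (r-1)/2\<close>,
  \<open>d = (r+1)/2\<close> and \<open>t = ln (k / (k-1))\<close>.
\<close>

text \<open>The newest ratio \<open>?q\<close> is a lower bound for all earlier ratios, hence for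
  their weighted mean, the old quotient. The new quotient is a mediant of the two, so it cannot
  exceed the old one.\<close>

lemma sum_quotient_antimono:
  fixes a b :: "nat \<Rightarrow> real"
  assumes pos: "\<And>k. k \<ge> 1 \<Longrightarrow> b k > 0"
    and dec: "\<And>k. k \<ge> 1 \<Longrightarrow> a (Suc k) / b (Suc k) \<le> a k / b k"
    and n: "n \<ge> 1"
  shows "(\<Sum>k=1..Suc n. a k) / (\<Sum>k=1..Suc n. b k) \<le> (\<Sum>k=1..n. a k) / (\<Sum>k=1..n. b k)"
proof -
  let ?q = "a (Suc n) / b (Suc n)"
  have le: "?q \<le> a k / b k" if "k \<ge> 1" "k \<le> Suc n" for k
    using that(2,1)
  proof (induction k rule: inc_induct)
    case (step k)
    then show ?case using dec[of k] by simp
  qed simp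
  have "?q * (\<Sum>k=1..n. b k) = (\<Sum>k=1..n. ?q * b k)"
    by (rule sum_distrib_left)
  also have "\<dots> \<le> (\<Sum>k=1..n. a k)"
    using le pos by (intro sum_mono) (simp add: pos_le_divide_eq)
  finally have "?q * (\<Sum>k=1..n. b k) \<le> (\<Sum>k=1..n. a k)" .
  moreover have B: "(\<Sum>k=1..n. b k) > 0"
    using n pos by (intro sum_pos) auto
  moreover have "b (Suc n) > 0"
    using pos by simp
  ultimately show ?thesis
    by (simp add: field_simps)
qed

text \<open>The derivative of the quotient has the sign of \<open>- ?N x\<close>. Here
  \<open>?N\<close> vanishes at 0 and, since the products of two cosh cancel, has derivative (d^2 -
  c^2) sinh(c x) sinh(d x), which is nonnegative.\<close>

lemma sinh_quotient_antimono:
  fixes c d s t :: real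
  assumes "0 \<le> c" "c \<le> d" "0 < d" "0 < s" "s \<le> t"
  shows "sinh (c * t) / sinh (d * t) \<le> sinh (c * s) / sinh (d * s)"
proof -
  have num: "c * cosh (c * x) * sinh (d * x) \<le> d * sinh (c * x) * cosh (d * x)" if "0 \<le> x" for x
  proof -
    let ?N = "\<lambda>x. d * sinh (c * x) * cosh (d * x) - c * cosh (c * x) * sinh (d * x)"
    have "?N 0 \<le> ?N x"
    proof (rule DERIV_nonneg_imp_nondecreasing[OF that])
      fix z assume z: "0 \<le> z" "z \<le> x"
      have "(?N has_real_derivative (d^2 - c^2) * (sinh (c * z) * sinh (d * z))) (at z)"
        by (auto intro!: derivative_eq_intros simp: algebra_simps power2_eq_square)
      moreover have "0 \<le> (d^2 - c^2) * (sinh (c * z) * sinh (d * z))"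
        using z assms by (intro mult_nonneg_nonneg) (auto intro: power_mono)
      ultimately show "\<exists>y. (?N has_real_derivative y) (at z) \<and> 0 \<le> y"
        by blast
    qed
    then show ?thesis by simp
  qed
  let ?Q = "\<lambda>x. sinh (c * x) / sinh (d * x)"
  show ?thesis
  proof (rule DERIV_nonpos_imp_nonincreasing[OF assms(5)])
    fix x assume x: "s \<le> x" "x \<le> t"
    then have "sinh (d * x) \<noteq> 0" using assms by simp
    then have "(?Q has_real_derivative
        (c * cosh (c * x) * sinh (d * x) - d * sinh (c * x) * cosh (d * x)) / (sinh (d * x))^2) (at x)"
      by (auto intro!: derivative_eq_intros simp: algebra_simps power2_eq_square)
    moreover have "(c * cosh (c * x) * sinh (d * x) - d * sinh (c * x) * cosh (d * x))
        / (sinh (d * x))^2 \<le> 0"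
      using num[of x] x assms by (intro divide_nonpos_nonneg) auto
    ultimately show "\<exists>y. (?Q has_real_derivative y) (at x) \<and> y \<le> 0"
      by blast
  qed
qed

text \<open>In exponential form, the two exponents in the numerator and the two in the denominator
  have the same mean (r+1)(u+v)/2. Factoring out its exponential leaves sinh of half the difference
  of the exponents.\<close>

lemma powr_quotient_eq_sinh_quotient:
  fixes p q r :: real
  assumes "0 < q" "0 < p"
  shows "(q * p powr r - p * q powr r) / (p powr (r + 1) - q powr (r + 1))
       = sinh ((r - 1) / 2 * ln (p / q)) / sinh ((r + 1) / 2 * ln (p / q))"
proof -
  define u v where "u = ln p" and "v = ln q"
  have pq: "p = exp u" "q = exp v" "ln (p / q) = u - v"
    using assms by (auto simp: u_def v_def ln_div)
  define E where "E = 2 * exp ((r + 1) / 2 * (u + v))"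
  have E: "E * sinh x = exp ((r + 1) / 2 * (u + v) + x) - exp ((r + 1) / 2 * (u + v) - x)" for x
  proof -
    have "2 * exp y * sinh x = exp (y + x) - exp (y - x)" for y :: real
      by (simp add: sinh_field_def exp_add exp_diff exp_minus field_simps)
    then show ?thesis by (simp only: E_def)
  qed
  have "(r + 1) / 2 * (u + v) + (r - 1) / 2 * (u - v) = v + r * u"
    "(r + 1) / 2 * (u + v) - (r - 1) / 2 * (u - v) = u + r * v"
    by (simp_all add: field_simps)
  then have "E * sinh ((r - 1) / 2 * (u - v)) = q * p powr r - p * q powr r"
    unfolding E by (simp add: pq powr_def exp_add)
  moreover have "(r + 1) / 2 * (u + v) + (r + 1) / 2 * (u - v) = (r + 1) * u"
    "(r + 1) / 2 * (u + v) - (r + 1) / 2 * (u - v) = (r + 1) * v"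
    by (simp_all add: field_simps)
  then have "E * sinh ((r + 1) / 2 * (u - v)) = p powr (r + 1) - q powr (r + 1)"
    unfolding E by (simp add: pq powr_def)
  moreover have "E \<noteq> 0"
    by (simp add: E_def)
  ultimately show ?thesis
    unfolding pq(3) by (metis mult_divide_mult_cancel_left)
qed

lemma trapezoid_increment_antimono:
  fixes r :: real and k :: nat
  assumes r: "r \<ge> 1" and k: "k \<ge> 1"
  defines "g \<equiv> \<lambda>p. (p powr r + (p - 1) powr r) / (p powr (r + 1) - (p - 1) powr (r + 1))"
  shows "g (real k + 1) \<le> g (real k)"
proof -
  have eq: "g p = 1 - sinh ((r - 1) / 2 * ln (p / (p - 1))) / sinh ((r + 1) / 2 * ln (p / (p - 1)))"
    if p: "p > 1" for p
  proof -
    have "(p - 1) powr (r + 1) < p powr (r + 1)"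
      using p r by (intro powr_less_mono2) auto
    moreover have "p powr r + (p - 1) powr r
        = (p powr (r + 1) - (p - 1) powr (r + 1)) - ((p - 1) * p powr r - p * (p - 1) powr r)"
      using p by (simp add: powr_add algebra_simps)
    ultimately have "g p = 1 - ((p - 1) * p powr r - p * (p - 1) powr r)
        / (p powr (r + 1) - (p - 1) powr (r + 1))"
      unfolding g_def by (simp add: diff_divide_distrib)
    then show ?thesis
      using p by (simp add: powr_quotient_eq_sinh_quotient)
  qed
  show ?thesis
  proof (cases "k = 1")
    case True
    have "0 \<le> sinh ((r - 1) / 2 * ln 2) / sinh ((r + 1) / 2 * ln (2::real))"
      using r by (intro divide_nonneg_nonneg) auto
    then have "g 2 \<le> 1"
      by (simp add: eq)
    then show ?thesis
      using True r by (simp add: g_def)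
  next
    case False
    then have k2: "real k > 1" using k by simp
    then have "(real k + 1) / real k \<le> real k / (real k - 1)"
      by (simp add: field_simps)
    then have "ln ((real k + 1) / real k) \<le> ln (real k / (real k - 1))"
      using k2 by (subst ln_le_cancel_iff) auto
    then have "sinh ((r - 1) / 2 * ln (real k / (real k - 1))) / sinh ((r + 1) / 2 * ln (real k / (real k - 1)))
        \<le> sinh ((r - 1) / 2 * ln ((real k + 1) / real k)) / sinh ((r + 1) / 2 * ln ((real k + 1) / real k))"
      using r k2 by (intro sinh_quotient_antimono) auto
    then show ?thesis
      using k2 eq[of "real k"] eq[of "real k + 1"] by simp
  qed
qed

lemma trapezoid_sum_antimono:
  fixes r :: real and n :: nat
  assumes r: "r \<ge> 1" and n: "n \<ge> 1"
  defines "S \<equiv> \<lambda>n. \<Sum>i=1..n. real i powr r"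
  shows "(S (Suc n) + S n) / real (Suc n) powr (r + 1) \<le> (S n + S (n - 1)) / real n powr (r + 1)"
proof -
  \<comment> \<open>Numerator and denominator are written as telescoping sums, whose increments have
    the ratio treated in the preceding lemma.\<close>
  define a where "a k = real k powr r + (real k - 1) powr r" for k :: nat
  define b where "b k = real k powr (r + 1) - (real k - 1) powr (r + 1)" for k :: nat
  have sum_a: "(\<Sum>k=1..n. a k) = S n + S (n - 1)" for n
  proof (induction n)
    case (Suc n)
    then show ?case by (cases n) (auto simp: a_def S_def)
  qed (simp add: S_def)
  have sum_b: "(\<Sum>k=1..n. b k) = real n powr (r + 1)" for n
    by (induction n) (auto simp: b_def)
  have "(\<Sum>k=1..Suc n. a k) / (\<Sum>k=1..Suc n. b k) \<le> (\<Sum>k=1..n. a k) / (\<Sum>k=1..n. b k)"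
  proof (rule sum_quotient_antimono[OF _ _ n])
    fix k :: nat assume k: "k \<ge> 1"
    then show "b k > 0"
      using r by (auto simp: b_def intro!: powr_less_mono2)
    show "a (Suc k) / b (Suc k) \<le> a k / b k"
      using trapezoid_increment_antimono[OF r k] by (simp add: a_def b_def add.commute)
  qed
  then show ?thesis
    unfolding sum_a sum_b by simp
qed

text \<open>This is convexity. The derivative test on the open interval is used because
  \<open>x\<close> may be 0, where \<open>powr\<close> need not be differentiable.\<close>

lemma powr_increment_mono:
  fixes p h x y :: real
  assumes "p \<ge> 1" "h \<ge> 0" "0 \<le> x" "x \<le> y"
  shows "(x + h) powr p - x powr p \<le> (y + h) powr p - y powr p"
proof (rule DERIV_nonneg_imp_increasing_open[OF assms(4)])
  fix z assume z: "x < z" "z < y"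
  have "((\<lambda>x. (x + h) powr p - x powr p) has_real_derivative
      p * (z + h) powr (p - 1) - p * z powr (p - 1)) (at z)"
    using z assms by (auto intro!: derivative_eq_intros)
  moreover have "p * z powr (p - 1) \<le> p * (z + h) powr (p - 1)"
    using z assms by (intro mult_left_mono powr_mono2) auto
  ultimately show "\<exists>l. ((\<lambda>x. (x + h) powr p - x powr p) has_real_derivative l) (at z) \<and> 0 \<le> l"
    by (metis diff_ge_0_iff_ge)
qed (use assms in \<open>auto intro!: continuous_intros continuous_on_powr'\<close>)

text \<open>The trapezoidal rule overestimates the integral of the convex function p x^(p-1) over
  [m-h, m+h]. The error \<open>?L\<close> is 0 at radius 0 and grows with the radius.\<close>

lemma powr_symmetric_increment_le:
  fixes p m h :: real
  assumes "p \<ge> 2" "0 \<le> h" "h < m"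
  shows "(m + h) powr p - (m - h) powr p
           \<le> h * (p * ((m + h) powr (p - 1) + (m - h) powr (p - 1)))"
proof -
  let ?L = "\<lambda>h. h * (p * ((m + h) powr (p - 1) + (m - h) powr (p - 1)))
               - ((m + h) powr p - (m - h) powr p)"
  have "?L 0 \<le> ?L h"
  proof (rule DERIV_nonneg_imp_nondecreasing[OF assms(2)])
    fix z assume z: "0 \<le> z" "z \<le> h"
    have "(?L has_real_derivative
        z * (p * ((p - 1) * ((m + z) powr (p - 2) - (m - z) powr (p - 2))))) (at z)"
      using z assms by (auto intro!: derivative_eq_intros simp: algebra_simps)
    moreover have "(m - z) powr (p - 2) \<le> (m + z) powr (p - 2)"
      using z assms by (intro powr_mono2) auto
    then have "0 \<le> z * (p * ((p - 1) * ((m + z) powr (p - 2) - (m - z) powr (p - 2))))"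
      using z assms by (intro mult_nonneg_nonneg) auto
    ultimately show "\<exists>y. (?L has_real_derivative y) (at z) \<and> 0 \<le> y"
      by blast
  qed
  then show ?thesis by simp
qed

text \<open>Differentiating in the radius gives exactly the trapezoidal error divided by z^2. The
  case \<open>h = m\<close> must be covered: it occurs for the first interval, which starts at
  0.\<close>

lemma powr_mean_slope_mono_radius:
  fixes p m h k :: real
  assumes "p \<ge> 2" "0 < k" "k \<le> h" "h \<le> m"
  shows "((m + k) powr p - (m - k) powr p) / k \<le> ((m + h) powr p - (m - h) powr p) / h"
proof (rule DERIV_nonneg_imp_increasing_open[OF assms(3)])
  let ?K = "\<lambda>h. ((m + h) powr p - (m - h) powr p) / h"
  fix z assume z: "k < z" "z < h"
  have "(?K has_real_derivative
      (z * (p * ((m + z) powr (p - 1) + (m - z) powr (p - 1)))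
        - ((m + z) powr p - (m - z) powr p)) / z^2) (at z)"
    using z assms by (auto intro!: derivative_eq_intros simp: algebra_simps power2_eq_square)
  moreover have "(m + z) powr p - (m - z) powr p
      \<le> z * (p * ((m + z) powr (p - 1) + (m - z) powr (p - 1)))"
    using z assms by (intro powr_symmetric_increment_le) auto
  then have "0 \<le> (z * (p * ((m + z) powr (p - 1) + (m - z) powr (p - 1)))
      - ((m + z) powr p - (m - z) powr p)) / z^2"
    by simp
  ultimately show "\<exists>l. (?K has_real_derivative l) (at z) \<and> 0 \<le> l"
    by blast
qed (use assms in \<open>auto intro!: continuous_intros continuous_on_powr'\<close>)

lemma powr_mean_slope_mono:
  fixes p m h m' h' :: real
  assumes "p \<ge> 2" "0 < h'" "h' \<le> h" "h' \<le> m'" "m' \<le> m" "h \<le> m"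
  shows "((m' + h') powr p - (m' - h') powr p) / h' \<le> ((m + h) powr p - (m - h) powr p) / h"
proof -
  \<comment> \<open>First move the centre from \<open>m'\<close> to \<open>m\<close> at fixed radius
    \<open>h'\<close>, then widen the radius to \<open>h\<close>.\<close>
  have "(m' + h') powr p - (m' - h') powr p \<le> (m + h') powr p - (m - h') powr p"
    using powr_increment_mono[of p "2 * h'" "m' - h'" "m - h'"] assms by (simp add: add.commute)
  then have "((m' + h') powr p - (m' - h') powr p) / h' \<le> ((m + h') powr p - (m - h') powr p) / h'"
    using assms by (simp add: divide_right_mono)
  also have "\<dots> \<le> ((m + h) powr p - (m - h) powr p) / h"
    using assms by (intro powr_mean_slope_mono_radius) auto
  finally show ?thesis .
qed

theorem theorem1p1:
  fixes r \<alpha> :: real and n :: nat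
  assumes "r \<ge> 1" and "\<alpha> \<ge> 2" and "n \<ge> 1"
  shows "(\<Sum>i=1..n. real i powr r) powr \<alpha> / (\<Sum>i=1..n. real i powr (\<alpha> * (r + 1) - 1))
       \<ge> (\<Sum>i=1..n+1. real i powr r) powr \<alpha> / (\<Sum>i=1..n+1. real i powr (\<alpha> * (r + 1) - 1))"
proof -
  note r = assms(1) and \<alpha> = assms(2) and n = assms(3)
  define S where "S n = (\<Sum>i=1..n. real i powr r)" for n :: nat
  define a where "a k = S k powr \<alpha> - S (k - 1) powr \<alpha>" for k :: nat
  define b where "b k = real k powr (\<alpha> * (r + 1) - 1)" for k :: nat
  \<comment> \<open>\<open>m k\<close> and \<open>h k\<close> are the midpoint and half-length of
    the interval from S(k-1)/k^(r+1) to S(k)/k^(r+1), whose length is k^r/k^(r+1) = 1/k.\<close>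
  define m where "m k = (S k + S (k - 1)) / real k powr (r + 1) / 2" for k :: nat
  define h where "h k = 1 / (2 * real k)" for k :: nat
  have S_nonneg: "S k \<ge> 0" for k
    by (simp add: S_def sum_nonneg)
  have S_rec: "S k = S (k - 1) + real k powr r" if "k \<ge> 1" for k
    using that by (cases k) (auto simp: S_def)
  have end_points: "m k + h k = S k / real k powr (r + 1)" "m k - h k = S (k - 1) / real k powr (r + 1)"
    if k: "k \<ge> 1" for k
  proof -
    have "h k = real k powr r / (2 * real k powr (r + 1))"
      using k by (simp add: h_def powr_add)
    then show "m k + h k = S k / real k powr (r + 1)" "m k - h k = S (k - 1) / real k powr (r + 1)"
      unfolding m_def S_rec[OF k] by (simp_all add: add_divide_distrib)
  qed
  have quot: "a k / b k = ((m k + h k) powr \<alpha> - (m k - h k) powr \<alpha>) / (2 * h k)" if k: "k \<ge> 1" for k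
  proof -
    \<comment> \<open>The exponent in \<open>b\<close> is chosen so that k^(r+1) rescales the
      endpoints and the leftover factor \<open>k\<close> is the reciprocal of the interval length
      \<open>2 * h k\<close>.\<close>
    have "b k = (real k powr (r + 1)) powr \<alpha> / real k"
      using k by (simp add: b_def powr_diff powr_powr mult.commute)
    then show ?thesis
      unfolding end_points[OF k] a_def
      using k S_nonneg by (simp add: powr_divide h_def flip: diff_divide_distrib)
  qed
  have sum_a: "(\<Sum>k=1..n. a k) = S n powr \<alpha>" for n
    by (induction n) (auto simp: a_def S_def)
  have "(\<Sum>k=1..Suc n. a k) / (\<Sum>k=1..Suc n. b k) \<le> (\<Sum>k=1..n. a k) / (\<Sum>k=1..n. b k)"
  proof (rule sum_quotient_antimono[OF _ _ n])
    fix k :: nat assume k: "k \<ge> 1"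
    then show "b k > 0"
      by (simp add: b_def)
    have hm: "h k \<le> m k" if "k \<ge> 1" for k
      using end_points(2)[OF that] S_nonneg[of "k - 1"]
      by (metis diff_ge_0_iff_ge divide_nonneg_nonneg powr_ge_zero)
    have "m (Suc k) \<le> m k"
      using trapezoid_sum_antimono[OF r k] by (simp add: m_def S_def)
    then have "((m (Suc k) + h (Suc k)) powr \<alpha> - (m (Suc k) - h (Suc k)) powr \<alpha>) / h (Suc k)
        \<le> ((m k + h k) powr \<alpha> - (m k - h k) powr \<alpha>) / h k"
      using k \<alpha> hm[of k] hm[of "Suc k"]
      by (intro powr_mean_slope_mono) (auto simp: h_def field_simps)
    then show "a (Suc k) / b (Suc k) \<le> a k / b k"
      using quot[of k] quot[of "Suc k"] k by simp
  qed
  then show ?thesis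
    unfolding sum_a by (simp add: S_def b_def)
qed

end
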